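(* Let $T$ be a complete first-order theory, let $\varphi(x;y)$ be a formula of $T$ and set $\theta(x;y,z)=\varphi(x;y)\wedge\neg\varphi(x;z)$. Let $\langle P_n\rangle$ be the characteristic sequence of $(T,\theta)$. The following are equivalent: (1) $\langle P_n\rangle$ has an $(\omega,2)$-diagram. (2) $R(x=x,\varphi(x;y),2)\ge\omega$, i.e. $\varphi$ is unstable. (3) $R(x=x,\theta(x;y,z),2)\ge\omega$, i.e. $\theta$ is unstable.
   Context: $x,y,z$ may be tuples of variables; parameters are drawn from a fixed sufficiently saturated (monster) model of $T$. The characteristic sequence of a formula $\theta(x;w)$ is given by $P_n(w_1,\dots,w_n):=\exists x\bigwedge_{i\le n}\theta(x;w_i)$ for $n\ge1$ (here $w=(y,z)$); $P_1$ also denotes the set it defines. $R(x=x,\psi,2)$ is Shelah's local 2-rank of $\psi$; it is $\ge\omega$ exactly when $\psi$ is unstable (has the order property). $\langle P_n\rangle$ has an $(\omega,2)$-diagram if there exist elements $\{a_\eta:\eta\in2^{<\omega}\}\subseteq P_1$ such that (writing $\subseteq$ for initial segment, and $\eta i$ for the sequence $\eta$ followed by $i$): for all $\eta\in2^{<\omega}$, $\neg P_2(a_{\eta 0},a_{\eta 1})$; and for all $n<\omega$ and $\eta_1,\dots,\eta_n\in2^{<\omega}$, $\eta_1\subseteq\dots\subseteq\eta_n\implies P_n(a_{\eta_1},\dots,a_{\eta_n})$. *)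

theory Defs
  imports Main "HOL-Library.Countable_Set" "HOL-Library.Sublist"
begin

section \<open>First-order logic with equality\<close>

text \<open>
  A language is given by its admissible (symbol, arity) pairs, so that it may also lack
  function or relation symbols altogether. Constants are function symbols of arity 0.
\<close>

record ('f, 'r) lang =
  funs :: "('f \<times> nat) set"
  rels :: "('r \<times> nat) set"

datatype 'f tm = Var nat | Fn 'f "'f tm list"

text \<open>Formulas use de Bruijn indices: \<open>All\<close> binds the variable 0 of its body.\<close>

datatype ('f, 'r) fm =
    Bot
  | Eq "'f tm" "'f tm"
  | Rel 'r "'f tm list"
  | Imp "('f, 'r) fm" "('f, 'r) fm"
  | All "('f, 'r) fm"

definition Neg :: "('f, 'r) fm \<Rightarrow> ('f, 'r) fm" where
  "Neg p = Imp p Bot"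

definition And :: "('f, 'r) fm \<Rightarrow> ('f, 'r) fm \<Rightarrow> ('f, 'r) fm" where
  "And p q = Neg (Imp p (Neg q))"

definition Exi :: "('f, 'r) fm \<Rightarrow> ('f, 'r) fm" where
  "Exi p = Neg (All (Neg p))"

definition Conj :: "('f, 'r) fm list \<Rightarrow> ('f, 'r) fm" where
  "Conj ps = foldr And ps (Neg Bot)"

primrec wf_tm :: "('f, 'r) lang \<Rightarrow> 'f tm \<Rightarrow> bool" where
  "wf_tm L (Var i) = True"
| "wf_tm L (Fn f ts) = ((f, length ts) \<in> funs L \<and> list_all id (map (wf_tm L) ts))"

primrec wf_fm :: "('f, 'r) lang \<Rightarrow> ('f, 'r) fm \<Rightarrow> bool" where
  "wf_fm L Bot = True"
| "wf_fm L (Eq s t) = (wf_tm L s \<and> wf_tm L t)"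
| "wf_fm L (Rel r ts) = ((r, length ts) \<in> rels L \<and> list_all (wf_tm L) ts)"
| "wf_fm L (Imp p q) = (wf_fm L p \<and> wf_fm L q)"
| "wf_fm L (All p) = wf_fm L p"

primrec fv_tm :: "'f tm \<Rightarrow> nat set" where
  "fv_tm (Var i) = {i}"
| "fv_tm (Fn f ts) = \<Union> (set (map fv_tm ts))"

primrec fv :: "('f, 'r) fm \<Rightarrow> nat set" where
  "fv Bot = {}"
| "fv (Eq s t) = fv_tm s \<union> fv_tm t"
| "fv (Rel r ts) = \<Union> (set (map fv_tm ts))"
| "fv (Imp p q) = fv p \<union> fv q"
| "fv (All p) = {i. Suc i \<in> fv p}"

definition sentence :: "('f, 'r) lang \<Rightarrow> ('f, 'r) fm \<Rightarrow> bool" where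
  "sentence L p \<longleftrightarrow> wf_fm L p \<and> fv p = {}"

primrec subst_tm :: "(nat \<Rightarrow> 'f tm) \<Rightarrow> 'f tm \<Rightarrow> 'f tm" where
  "subst_tm s (Var i) = s i"
| "subst_tm s (Fn f ts) = Fn f (map (subst_tm s) ts)"

primrec subst_fm :: "(nat \<Rightarrow> 'f tm) \<Rightarrow> ('f, 'r) fm \<Rightarrow> ('f, 'r) fm" where
  "subst_fm s Bot = Bot"
| "subst_fm s (Eq t u) = Eq (subst_tm s t) (subst_tm s u)"
| "subst_fm s (Rel r ts) = Rel r (map (subst_tm s) ts)"
| "subst_fm s (Imp p q) = Imp (subst_fm s p) (subst_fm s q)"
| "subst_fm s (All p) =
     All (subst_fm (case_nat (Var 0) (\<lambda>i. subst_tm (\<lambda>j. Var (Suc j)) (s i))) p)"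

definition shift :: "('f, 'r) fm \<Rightarrow> ('f, 'r) fm" where
  "shift p = subst_fm (\<lambda>i. Var (Suc i)) p"

text \<open>Instantiation of the variable 0, lowering the other variables by one.\<close>

definition inst :: "'f tm \<Rightarrow> ('f, 'r) fm \<Rightarrow> ('f, 'r) fm" where
  "inst t p = subst_fm (case_nat t Var) p"

text \<open>
  Natural deduction. Semantic consequence would have to range over structures on all types,
  so completeness of a theory is expressed through provability.
\<close>

inductive deriv :: "('f, 'r) lang \<Rightarrow> ('f, 'r) fm set \<Rightarrow> ('f, 'r) fm \<Rightarrow> bool"
  for L :: "('f, 'r) lang" where
  Ax: "p \<in> G \<Longrightarrow> deriv L G p"
| ImpI: "wf_fm L p \<Longrightarrow> deriv L (insert p G) q \<Longrightarrow> deriv L G (Imp p q)"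
| ImpE: "deriv L G (Imp p q) \<Longrightarrow> deriv L G p \<Longrightarrow> deriv L G q"
| Contr: "wf_fm L p \<Longrightarrow> deriv L (insert (Neg p) G) Bot \<Longrightarrow> deriv L G p"
| AllI: "deriv L (shift ` G) p \<Longrightarrow> deriv L G (All p)"
| AllE: "deriv L G (All p) \<Longrightarrow> wf_tm L t \<Longrightarrow> deriv L G (inst t p)"
| EqI: "wf_tm L t \<Longrightarrow> deriv L G (Eq t t)"
| EqE: "deriv L G (Eq s t) \<Longrightarrow> deriv L G (inst s p) \<Longrightarrow> deriv L G (inst t p)"

definition complete_theory :: "('f, 'r) lang \<Rightarrow> ('f, 'r) fm set \<Rightarrow> bool" where
  "complete_theory L T \<longleftrightarrow>
     (\<forall>p\<in>T. sentence L p) \<and>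
     \<not> deriv L T Bot \<and>
     (\<forall>p. sentence L p \<longrightarrow> deriv L T p \<or> deriv L T (Neg p))"


section \<open>Structures and types\<close>

text \<open>
  The universe of a structure is the whole (automatically nonempty) type \<^typ>\<open>'a\<close>.
  Interpretations at lengths that are not arities in the language are irrelevant.
\<close>

record ('f, 'r, 'a) struct =
  fun_int :: "'f \<Rightarrow> 'a list \<Rightarrow> 'a"
  rel_int :: "'r \<Rightarrow> 'a list \<Rightarrow> bool"

primrec val :: "('f, 'r, 'a) struct \<Rightarrow> (nat \<Rightarrow> 'a) \<Rightarrow> 'f tm \<Rightarrow> 'a" where
  "val M e (Var i) = e i"
| "val M e (Fn f ts) = fun_int M f (map (val M e) ts)"

primrec sat :: "('f, 'r, 'a) struct \<Rightarrow> (nat \<Rightarrow> 'a) \<Rightarrow> ('f, 'r) fm \<Rightarrow> bool" where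
  "sat M e Bot = False"
| "sat M e (Eq s t) = (val M e s = val M e t)"
| "sat M e (Rel r ts) = rel_int M r (map (val M e) ts)"
| "sat M e (Imp p q) = (sat M e p \<longrightarrow> sat M e q)"
| "sat M e (All p) = (\<forall>a. sat M (case_nat a e) p)"

definition models :: "('f, 'r, 'a) struct \<Rightarrow> ('f, 'r) fm set \<Rightarrow> bool" where
  "models M T \<longleftrightarrow> (\<forall>p\<in>T. \<forall>e. sat M e p)"

text \<open>
  Satisfaction by a tuple; used only when the free variables of \<open>p\<close> are below \<open>length a\<close>,
  where the value of \<open>a ! i\<close> for out-of-range \<open>i\<close> does not matter.
\<close>

definition holds :: "('f, 'r, 'a) struct \<Rightarrow> ('f, 'r) fm \<Rightarrow> 'a list \<Rightarrow> bool" where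
  "holds M p a \<longleftrightarrow> sat M (\<lambda>i. a ! i) p"

text \<open>
  A formula with parameters is a pair \<open>(p, b)\<close>: in \<open>m\<close> type variables, the variables
  \<open>0, \<dots>, m - 1\<close> of \<open>p\<close> are the type variables and the variables from \<open>m\<close> on stand for the
  entries of \<open>b\<close>.
\<close>

type_synonym ('f, 'r, 'a) pfm = "('f, 'r) fm \<times> 'a list"

definition pfm_over :: "('f, 'r) lang \<Rightarrow> nat \<Rightarrow> 'a set \<Rightarrow> ('f, 'r, 'a) pfm set" where
  "pfm_over L m A = {(p, b). wf_fm L p \<and> fv p \<subseteq> {..<m + length b} \<and> set b \<subseteq> A}"

definition realizes ::
    "('f, 'r, 'a) struct \<Rightarrow> nat \<Rightarrow> 'a list \<Rightarrow> ('f, 'r, 'a) pfm set \<Rightarrow> bool" where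
  "realizes M m a \<Gamma> \<longleftrightarrow> length a = m \<and> (\<forall>(p, b)\<in>\<Gamma>. holds M p (a @ b))"

text \<open>Consistency with the elementary diagram of \<open>M\<close>.\<close>

definition consistent_type ::
    "('f, 'r, 'a) struct \<Rightarrow> nat \<Rightarrow> ('f, 'r, 'a) pfm set \<Rightarrow> bool" where
  "consistent_type M m \<Gamma> \<longleftrightarrow> (\<forall>\<Delta>\<subseteq>\<Gamma>. finite \<Delta> \<longrightarrow> (\<exists>a. realizes M m a \<Delta>))"

definition aleph1_saturated :: "('f, 'r) lang \<Rightarrow> ('f, 'r, 'a) struct \<Rightarrow> bool" where
  "aleph1_saturated L M \<longleftrightarrow>
     (\<forall>A m \<Gamma>. countable A \<longrightarrow> \<Gamma> \<subseteq> pfm_over L m A \<longrightarrow> consistent_type M m \<Gamma> \<longrightarrow>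
        (\<exists>a. realizes M m a \<Gamma>))"


section \<open>Shelah's local 2-rank\<close>

text \<open>
  A partitioned formula \<open>\<psi>(x;w)\<close> with \<open>|x| = m\<close> and \<open>|w| = l\<close> has the variables
  \<open>0, \<dots>, m - 1\<close> for \<open>x\<close> and \<open>m, \<dots>, m + l - 1\<close> for \<open>w\<close>.
\<close>

definition local_type :: "('f, 'r) fm \<Rightarrow> nat \<Rightarrow> ('f, 'r, 'a) pfm set \<Rightarrow> bool" where
  "local_type \<psi> l \<Gamma> \<longleftrightarrow> (\<forall>(p, b)\<in>\<Gamma>. (p = \<psi> \<or> p = Neg \<psi>) \<and> length b = l)"

definition explicitly_contradictory ::
    "('f, 'r, 'a) pfm set \<Rightarrow> ('f, 'r, 'a) pfm set \<Rightarrow> bool" where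
  "explicitly_contradictory \<Gamma> \<Delta> \<longleftrightarrow>
     (\<exists>p b. ((p, b) \<in> \<Gamma> \<and> (Neg p, b) \<in> \<Delta>) \<or> ((Neg p, b) \<in> \<Gamma> \<and> (p, b) \<in> \<Delta>))"

text \<open>
  \<open>rank2_ge M m \<psi> l n \<Gamma>\<close> says \<open>R(\<Gamma>, \<psi>, 2) \<ge> n\<close>. The successor clause of \<open>R(\<Gamma>, \<psi>, \<lambda>)\<close> asks,
  for all \<open>\<mu> < \<lambda>\<close>, for \<open>\<mu> + 1\<close> pairwise explicitly contradictory \<open>\<psi>\<close>-types; for \<open>\<lambda> = 2\<close>
  the instance \<open>\<mu> = 1\<close> subsumes \<open>\<mu> = 0\<close>.
\<close>

primrec rank2_ge ::
    "('f, 'r, 'a) struct \<Rightarrow> nat \<Rightarrow> ('f, 'r) fm \<Rightarrow> nat \<Rightarrow> nat \<Rightarrow> ('f, 'r, 'a) pfm set \<Rightarrow> bool" where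
  "rank2_ge M m \<psi> l 0 \<Gamma> = consistent_type M m \<Gamma>"
| "rank2_ge M m \<psi> l (Suc n) \<Gamma> =
     (\<forall>\<Delta>\<subseteq>\<Gamma>. finite \<Delta> \<longrightarrow>
        (\<exists>\<Delta>\<^sub>0 \<Delta>\<^sub>1. local_type \<psi> l \<Delta>\<^sub>0 \<and> local_type \<psi> l \<Delta>\<^sub>1 \<and>
           explicitly_contradictory \<Delta>\<^sub>0 \<Delta>\<^sub>1 \<and>
           rank2_ge M m \<psi> l n (\<Delta> \<union> \<Delta>\<^sub>0) \<and> rank2_ge M m \<psi> l n (\<Delta> \<union> \<Delta>\<^sub>1)))"

definition rank2_ge_omega ::
    "('f, 'r, 'a) struct \<Rightarrow> nat \<Rightarrow> ('f, 'r) fm \<Rightarrow> nat \<Rightarrow> ('f, 'r, 'a) pfm set \<Rightarrow> bool" where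
  "rank2_ge_omega M m \<psi> l \<Gamma> \<longleftrightarrow> (\<forall>n. rank2_ge M m \<psi> l n \<Gamma>)"

text \<open>The type \<open>{x = x}\<close> for a tuple \<open>x\<close> of \<open>m\<close> variables.\<close>

definition x_eq_x :: "nat \<Rightarrow> ('f, 'r, 'a) pfm set" where
  "x_eq_x m = {(Conj (map (\<lambda>i. Eq (Var i) (Var i)) [0..<m]), [])}"


section \<open>Characteristic sequences\<close>

text \<open>
  \<open>\<theta>(x;y,z) = \<phi>(x;y) \<and> \<not> \<phi>(x;z)\<close> for \<open>|x| = m\<close> and \<open>|y| = |z| = k\<close>; \<open>z\<close> occupies the
  variables \<open>m + k, \<dots>, m + 2 * k - 1\<close>.
\<close>

definition theta :: "nat \<Rightarrow> nat \<Rightarrow> ('f, 'r) fm \<Rightarrow> ('f, 'r) fm" where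
  "theta m k \<phi> = And \<phi> (Neg (subst_fm (\<lambda>i. if i < m then Var i else Var (i + k)) \<phi>))"

text \<open>
  The formula \<open>P\<^sub>n(w\<^sub>1, \<dots>, w\<^sub>n) = \<exists>x. \<And>i\<le>n. \<theta>(x;w\<^sub>i)\<close>, where \<open>|x| = m\<close> and every \<open>w\<^sub>i\<close> has
  length \<open>l\<close>. Below the \<open>m\<close> quantifiers, \<open>x\<close> is \<open>0, \<dots>, m - 1\<close> and the concatenation of the
  \<open>w\<^sub>i\<close> starts at \<open>m\<close>; in the resulting formula it starts at \<open>0\<close>.
\<close>

definition char_fm :: "nat \<Rightarrow> nat \<Rightarrow> ('f, 'r) fm \<Rightarrow> nat \<Rightarrow> ('f, 'r) fm" where
  "char_fm m l \<theta> n =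
     (Exi ^^ m) (Conj (map
        (\<lambda>i. subst_fm (\<lambda>j. if j < m then Var j else Var (j + i * l)) \<theta>) [0..<n]))"

text \<open>The relation defined by \<open>P\<^sub>n\<close> in \<open>M\<close>, on lists of \<open>n\<close> tuples of length \<open>l\<close>.\<close>

definition char_seq ::
    "('f, 'r, 'a) struct \<Rightarrow> nat \<Rightarrow> nat \<Rightarrow> ('f, 'r) fm \<Rightarrow> nat \<Rightarrow> 'a list list \<Rightarrow> bool" where
  "char_seq M m l \<theta> n ws \<longleftrightarrow>
     length ws = n \<and> (\<forall>w\<in>set ws. length w = l) \<and> holds M (char_fm m l \<theta> n) (concat ws)"

definition has_omega_2_diagram :: "(nat \<Rightarrow> 'b list \<Rightarrow> bool) \<Rightarrow> bool" where
  "has_omega_2_diagram P \<longleftrightarrow>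
     (\<exists>a :: bool list \<Rightarrow> 'b.
        (\<forall>\<eta>. P 1 [a \<eta>]) \<and>
        (\<forall>\<eta>. \<not> P 2 [a (\<eta> @ [False]), a (\<eta> @ [True])]) \<and>
        (\<forall>n\<ge>1. \<forall>\<eta>s. length \<eta>s = n \<and> sorted_wrt prefix \<eta>s \<longrightarrow> P n (map a \<eta>s)))"

end

theory Submission
  imports Defs
begin

text \<open>
  The relations involved only matter through the subsets that they cut out of \<open>M\<^sup>m\<close>. Call a set
  \<open>X\<close> splittable to depth \<open>n\<close> if instances of the formula can be arranged in a binary tree of
  height \<open>n\<close> each of whose branches is realized in \<open>X\<close>; then \<open>R(x = x, \<psi>, 2) \<ge> \<omega>\<close> says that
  \<open>M\<^sup>m\<close> is splittable to every finite depth (\<open>rank2_ge_omega_iff_splits\<close>).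

  From \<open>\<theta>\<close> to \<open>\<phi>\<close>: if \<open>\<theta>(x;b,c)\<close> splits \<open>X\<close>, then its complement in \<open>X\<close> is covered by
  \<open>\<not> \<phi>(x;b)\<close> and \<open>\<phi>(x;c)\<close>. A deep tree on a union of two sets leaves a deep tree on one of them
  (\<open>splits_Un\<close>), so either \<open>\<phi>(x;b)\<close> or \<open>\<phi>(x;c)\<close> already separates two parts of \<open>X\<close> that are
  splittable to about half the depth (\<open>splits_of_splits_diff\<close>).

  From \<open>\<phi>\<close> to a diagram: by saturation, a definable set \<open>X\<close> that is splittable to every depth is
  divided by a single instance \<open>\<phi>(x;c)\<close> into two sets of the same kind
  (\<open>unbounded_split\<close>). Reading \<open>\<theta>(x;y,z)\<close> as \<open>x\<close> lying in an interval from \<open>z\<close> to \<open>y\<close>, such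
  a \<open>c\<close> cuts the interval \<open>(y,z)\<close> into \<open>(c,z)\<close> and \<open>(y,c)\<close>. These halves are
  disjoint, as one requires \<open>\<phi>(x;c)\<close> and the other \<open>\<not> \<phi>(x;c)\<close>, and iterating the bisection
  produces the diagram (\<open>bisection_tree\<close>).

  From a diagram to \<open>\<theta>\<close>: as siblings are contradictory, a point satisfying the formula at the
  right child falsifies it at the left child, so the left children form a binary
  tree for \<open>\<theta>\<close> (\<open>splits_of_diagram\<close>).
\<close>

section \<open>Splitting trees of a relation\<close>

primrec splits :: "('x \<Rightarrow> 'b \<Rightarrow> bool) \<Rightarrow> 'b set \<Rightarrow> nat \<Rightarrow> 'x set \<Rightarrow> bool" where
  "splits R B 0 X \<longleftrightarrow> X \<noteq> {}"
| "splits R B (Suc n) X \<longleftrightarrow>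
     (\<exists>b\<in>B. splits R B n {x \<in> X. R x b} \<and> splits R B n {x \<in> X. \<not> R x b})"

lemma splits_mono: "splits R B n X \<Longrightarrow> X \<subseteq> Y \<Longrightarrow> splits R B n Y"
proof (induction n arbitrary: X Y)
  case 0
  then show ?case by auto
next
  case (Suc n)
  then obtain b where b: "b \<in> B" "splits R B n {x \<in> X. R x b}" "splits R B n {x \<in> X. \<not> R x b}"
    by auto
  have "splits R B n {x \<in> Y. R x b}" "splits R B n {x \<in> Y. \<not> R x b}"
    by (rule Suc.IH[OF b(2)], use Suc.prems(2) in blast, rule Suc.IH[OF b(3)], use Suc.prems(2) in blast)
  with b(1) show ?case by auto
qed

lemma splits_Suc_imp: "splits R B (Suc n) X \<Longrightarrow> splits R B n X"
  by (auto elim: splits_mono)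

lemma splits_le: "splits R B n X \<Longrightarrow> i \<le> n \<Longrightarrow> splits R B i X"
  by (induction n) (auto simp: le_Suc_eq simp del: splits.simps dest: splits_Suc_imp)

text \<open>
  If neither half of the top split yields a tree of height \<open>b\<close> on \<open>Y\<close>, then both yield a tree of
  height \<open>a - 1\<close> on \<open>X\<close>, and the top split joins these two.
\<close>

lemma splits_Un: "splits R B (a + b) (X \<union> Y) \<Longrightarrow> splits R B a X \<or> splits R B b Y"
proof (induction a arbitrary: X Y)
  case 0
  then show ?case by (cases "X = {}") auto
next
  case (Suc a)
  then obtain c where c: "c \<in> B" "splits R B (a + b) {x \<in> X \<union> Y. R x c}"
      "splits R B (a + b) {x \<in> X \<union> Y. \<not> R x c}"
    by auto
  have halves: "{x \<in> X \<union> Y. R x c} = {x \<in> X. R x c} \<union> {x \<in> Y. R x c}"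
    "{x \<in> X \<union> Y. \<not> R x c} = {x \<in> X. \<not> R x c} \<union> {x \<in> Y. \<not> R x c}"
    by auto
  have "splits R B a {x \<in> X. R x c} \<or> splits R B b {x \<in> Y. R x c}"
    by (rule Suc.IH[OF c(2)[unfolded halves(1)]])
  moreover have "splits R B a {x \<in> X. \<not> R x c} \<or> splits R B b {x \<in> Y. \<not> R x c}"
    by (rule Suc.IH[OF c(3)[unfolded halves(2)]])
  moreover have "splits R B b {x \<in> Y. R x c} \<Longrightarrow> splits R B b Y"
      "splits R B b {x \<in> Y. \<not> R x c} \<Longrightarrow> splits R B b Y"
    by (erule splits_mono, blast)+
  ultimately show ?case unfolding splits.simps using c(1) by blast
qed

text \<open>
  The depth \<open>2\<^sup>n - 1\<close> satisfies the recursion \<open>N (n + 1) = 2 * N n + 1\<close>: one level is spent on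
  the instance of the difference, and the rest is halved by \<open>splits_Un\<close>.
\<close>

lemma splits_of_splits_diff:
  assumes S: "\<And>x w. x \<in> U \<Longrightarrow> w \<in> C \<Longrightarrow> S x w \<longleftrightarrow> R x (f w) \<and> \<not> R x (g w)"
    and B: "\<And>w. w \<in> C \<Longrightarrow> f w \<in> B" "\<And>w. w \<in> C \<Longrightarrow> g w \<in> B"
  shows "splits S C (2 ^ n - 1) X \<Longrightarrow> X \<subseteq> U \<Longrightarrow> splits R B n X"
proof (induction n arbitrary: X)
  case 0
  then show ?case by simp
next
  case (Suc n)
  define N :: nat where "N = 2 ^ n - 1"
  have "1 \<le> (2::nat) ^ n" by simp
  then have "(2::nat) ^ Suc n - 1 = Suc (N + N)"
    unfolding N_def power_Suc by linarith
  with Suc.prems(1) obtain w where w: "w \<in> C" "splits S C (N + N) {x \<in> X. S x w}"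
      "splits S C (N + N) {x \<in> X. \<not> S x w}"
    by auto
  have S': "S x w \<longleftrightarrow> R x (f w) \<and> \<not> R x (g w)" if "x \<in> X" for x
    using S w(1) Suc.prems(2) that by blast
  have inside: "splits S C N {x \<in> X. S x w}"
    using w(2) by (rule splits_le) simp
  have "{x \<in> X. \<not> S x w} = {x \<in> X. \<not> R x (f w)} \<union> {x \<in> X. R x (g w)}"
    using S' by auto
  with w(3) have "splits S C (N + N) ({x \<in> X. \<not> R x (f w)} \<union> {x \<in> X. R x (g w)})"
    by simp
  then consider "splits S C N {x \<in> X. \<not> R x (f w)}" | "splits S C N {x \<in> X. R x (g w)}"
    by (rule splits_Un[THEN disjE])
  then show ?case
  proof cases
    case 1
    moreover have "splits S C N {x \<in> X. R x (f w)}"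
      using inside by (rule splits_mono) (use S' in auto)
    ultimately show ?thesis
      using Suc.IH[folded N_def] Suc.prems(2) B(1)[OF w(1)] by auto
  next
    case 2
    moreover have "splits S C N {x \<in> X. \<not> R x (g w)}"
      using inside by (rule splits_mono) (use S' in auto)
    ultimately show ?thesis
      using Suc.IH[folded N_def] Suc.prems(2) B(2)[OF w(1)] by auto
  qed
qed

text \<open>
  A node of the diagram is split by the parameter of its left child: its right child lies in
  the complement, being incompatible with the left one.
\<close>

lemma splits_of_diagram:
  assumes B: "\<And>\<eta>. a \<eta> \<in> B"
    and siblings: "\<And>\<eta> x. x \<in> U \<Longrightarrow> R x (a (\<eta> @ [False])) \<Longrightarrow> \<not> R x (a (\<eta> @ [True]))"
    and branches: "\<And>\<eta>. \<exists>x\<in>U. \<forall>\<nu>. prefix \<nu> \<eta> \<longrightarrow> R x (a \<nu>)"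
  shows "splits R B n U"
proof -
  define X where "X \<eta> = {x \<in> U. \<forall>\<nu>. prefix \<nu> \<eta> \<longrightarrow> R x (a \<nu>)}" for \<eta>
  have "splits R B n (X \<eta>)" for \<eta>
  proof (induction n arbitrary: \<eta>)
    case 0
    show ?case using branches[of \<eta>] by (auto simp: X_def)
  next
    case (Suc n)
    have left: "X (\<eta> @ [False]) \<subseteq> {x \<in> X \<eta>. R x (a (\<eta> @ [False]))}"
      by (auto simp: X_def)
    have right: "X (\<eta> @ [True]) \<subseteq> {x \<in> X \<eta>. \<not> R x (a (\<eta> @ [False]))}"
      using siblings by (auto simp: X_def)
    show ?case
      unfolding splits.simps
      by (intro bexI[OF _ B[of "\<eta> @ [False]"]] conjI splits_mono[OF Suc left] splits_mono[OF Suc right])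
  qed
  then show ?thesis
    by (rule splits_mono[of _ _ _ "X []"]) (auto simp: X_def)
qed

text \<open>
  Bisection. A node carries a good set together with the interval \<open>(y, z)\<close> that
  contains it; the two initial splits supply the interval of the root.
\<close>

lemma bisection_tree:
  assumes good: "good U"
    and step: "\<And>X. good X \<Longrightarrow> \<exists>c\<in>B. good {x \<in> X. R x c} \<and> good {x \<in> X. \<not> R x c}"
    and nonempty: "\<And>X. good X \<Longrightarrow> X \<noteq> {}"
  obtains y z :: "bool list \<Rightarrow> 'b"
  where "\<And>\<eta>. y \<eta> \<in> B" "\<And>\<eta>. z \<eta> \<in> B" "\<And>\<eta>. y (\<eta> @ [False]) = z (\<eta> @ [True])"
    "\<And>\<eta>. \<exists>x\<in>U. \<forall>\<nu>. prefix \<nu> \<eta> \<longrightarrow> R x (y \<nu>) \<and> \<not> R x (z \<nu>)"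
proof -
  obtain cut where cut: "\<And>X. good X \<Longrightarrow> cut X \<in> B" "\<And>X. good X \<Longrightarrow> good {x \<in> X. R x (cut X)}"
      "\<And>X. good X \<Longrightarrow> good {x \<in> X. \<not> R x (cut X)}"
    using step by metis
  define y0 where "y0 = cut U"
  define z0 where "z0 = cut {x \<in> U. R x y0}"
  define X0 where "X0 = {x \<in> {x \<in> U. R x y0}. \<not> R x z0}"
  define child where "child = (\<lambda>b (X, y, z).
    if b then ({x \<in> X. \<not> R x (cut X)}, y, cut X) else ({x \<in> X. R x (cut X)}, cut X, z))"
  define node where "node \<eta> = fold child \<eta> (X0, y0, z0)" for \<eta>
  define X y z where "X \<eta> = fst (node \<eta>)" and "y \<eta> = fst (snd (node \<eta>))"
    and "z \<eta> = snd (snd (node \<eta>))" for \<eta>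
  have node: "node \<eta> = (X \<eta>, y \<eta>, z \<eta>)" for \<eta>
    by (simp add: X_def y_def z_def)
  have root: "X [] = X0" "y [] = y0" "z [] = z0"
    by (simp_all add: X_def y_def z_def node_def)
  have "node (\<eta> @ [b]) = child b (X \<eta>, y \<eta>, z \<eta>)" for \<eta> b
    by (simp add: node_def flip: node)
  then have child: "X (\<eta> @ [b]) = (if b then {x \<in> X \<eta>. \<not> R x (cut (X \<eta>))} else {x \<in> X \<eta>. R x (cut (X \<eta>))})"
      "y (\<eta> @ [b]) = (if b then y \<eta> else cut (X \<eta>))"
      "z (\<eta> @ [b]) = (if b then cut (X \<eta>) else z \<eta>)" for \<eta> b
    unfolding X_def[of "\<eta> @ [b]"] y_def[of "\<eta> @ [b]"] z_def[of "\<eta> @ [b]"]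
    by (simp_all add: child_def)
  have inv: "good (X \<eta>) \<and> y \<eta> \<in> B \<and> z \<eta> \<in> B \<and> X \<eta> \<subseteq> U \<and> (\<forall>x\<in>X \<eta>. R x (y \<eta>) \<and> \<not> R x (z \<eta>))" for \<eta>
  proof (induction \<eta> rule: rev_induct)
    case Nil
    have "good X0"
      unfolding X0_def z0_def y0_def by (rule cut(3)[OF cut(2)[OF good]])
    moreover have "y0 \<in> B" "z0 \<in> B"
      unfolding z0_def y0_def by (rule cut(1)[OF good], rule cut(1)[OF cut(2)[OF good]])
    ultimately show ?case by (auto simp: root X0_def)
  next
    case (snoc b \<eta>)
    then show ?case by (auto simp: child cut)
  qed
  have mono: "X \<eta> \<subseteq> X \<nu>" if "prefix \<nu> \<eta>" for \<nu> \<eta>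
    using that by (induction \<eta> rule: rev_induct) (auto simp: child split: if_splits)
  have "\<exists>x\<in>U. \<forall>\<nu>. prefix \<nu> \<eta> \<longrightarrow> R x (y \<nu>) \<and> \<not> R x (z \<nu>)" for \<eta>
  proof -
    obtain x where "x \<in> X \<eta>" using nonempty inv by blast
    then show ?thesis using inv mono by blast
  qed
  then show thesis
    using that[of y z] inv child by simp
qed


section \<open>Satisfaction\<close>

lemma val_cong: "(\<And>i. i \<in> fv_tm t \<Longrightarrow> e i = e' i) \<Longrightarrow> val M e t = val M e' t"
proof (induction t)
  case (Fn f ts)
  then have "map (val M e) ts = map (val M e') ts" by auto
  then show ?case by (simp only: val.simps)
qed simp

lemma sat_cong: "(\<And>i. i \<in> fv p \<Longrightarrow> e i = e' i) \<Longrightarrow> sat M e p = sat M e' p"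
proof (induction p arbitrary: e e')
  case (Eq s t)
  then have "val M e s = val M e' s" "val M e t = val M e' t"
    by (auto intro!: val_cong)
  then show ?case by simp
next
  case (Rel r ts)
  then have "map (val M e) ts = map (val M e') ts"
    by (auto intro!: val_cong)
  then show ?case by (simp only: sat.simps)
next
  case (Imp p q)
  have "sat M e p = sat M e' p"
    by (rule Imp.IH(1), rule Imp.prems) simp
  moreover have "sat M e q = sat M e' q"
    by (rule Imp.IH(2), rule Imp.prems) simp
  ultimately show ?case by simp
next
  case (All p)
  have "sat M (case_nat a e) p = sat M (case_nat a e') p" for a
  proof (rule All.IH)
    show "case_nat a e i = case_nat a e' i" if "i \<in> fv p" for i
      using that All.prems by (cases i) auto
  qed
  then show ?case by simp
qed simp

lemma finite_fv_tm: "finite (fv_tm t)"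
  by (induction t) auto

lemma finite_fv: "finite (fv p)"
proof (induction p)
  case (All p)
  then have "finite (Suc -` fv p)" by (rule finite_vimageI) simp
  then show ?case by (simp add: vimage_def)
qed (auto simp: finite_fv_tm)

lemma val_subst: "val M e (subst_tm s t) = val M (\<lambda>i. val M e (s i)) t"
proof (induction t)
  case (Fn f ts)
  then have "map (val M e \<circ> subst_tm s) ts = map (val M (\<lambda>i. val M e (s i))) ts" by simp
  then show ?case by (simp only: subst_tm.simps val.simps map_map)
qed simp

lemma sat_subst: "sat M e (subst_fm s p) = sat M (\<lambda>i. val M e (s i)) p"
proof (induction p arbitrary: e s)
  case (All p)
  have "(\<lambda>i. val M (case_nat a e) (case_nat (Var 0) (\<lambda>i. subst_tm (\<lambda>j. Var (Suc j)) (s i)) i))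
      = case_nat a (\<lambda>i. val M e (s i))" for a
    by (rule ext) (simp add: val_subst split: nat.split)
  with All show ?case by simp
next
  case (Rel r ts)
  have "map (val M e \<circ> subst_tm s) ts = map (val M (\<lambda>i. val M e (s i))) ts"
    by (simp add: val_subst)
  then show ?case by (simp only: subst_fm.simps sat.simps map_map)
qed (simp_all add: val_subst)

lemma wf_subst_tm: "(\<And>i. wf_tm L (s i)) \<Longrightarrow> wf_tm L t \<Longrightarrow> wf_tm L (subst_tm s t)"
  by (induction t) (auto simp: list_all_iff)

lemma wf_subst_fm: "(\<And>i. wf_tm L (s i)) \<Longrightarrow> wf_fm L p \<Longrightarrow> wf_fm L (subst_fm s p)"
proof (induction p arbitrary: s)
  case (All p)
  have "wf_tm L (case_nat (Var 0) (\<lambda>i. subst_tm (\<lambda>j. Var (Suc j)) (s i)) i)" for i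
    using All.prems by (auto intro: wf_subst_tm split: nat.split)
  with All show ?case by simp
qed (auto simp: list_all_iff intro: wf_subst_tm)

lemma sat_Neg [simp]: "sat M e (Neg p) \<longleftrightarrow> \<not> sat M e p"
  by (simp add: Neg_def)

lemma sat_And [simp]: "sat M e (And p q) \<longleftrightarrow> sat M e p \<and> sat M e q"
  by (simp add: And_def)

lemma sat_Exi [simp]: "sat M e (Exi p) \<longleftrightarrow> (\<exists>a. sat M (case_nat a e) p)"
  by (simp add: Exi_def)

lemma sat_Conj [simp]: "sat M e (Conj ps) \<longleftrightarrow> (\<forall>p\<in>set ps. sat M e p)"
  by (induction ps) (simp_all add: Conj_def)

lemma wf_Neg [simp]: "wf_fm L (Neg p) \<longleftrightarrow> wf_fm L p"
  by (simp add: Neg_def)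

lemma wf_And [simp]: "wf_fm L (And p q) \<longleftrightarrow> wf_fm L p \<and> wf_fm L q"
  by (simp add: And_def)

lemma wf_Exi_pow [simp]: "wf_fm L ((Exi ^^ n) p) \<longleftrightarrow> wf_fm L p"
  by (induction n) (simp_all add: Exi_def)

text \<open>
  Under a block of \<open>length a\<close> quantifiers the de Bruijn indices of the outer variables are raised
  by \<open>length a\<close>; \<open>prepend a e\<close> is the assignment seen from inside the block.
\<close>

definition prepend :: "'a list \<Rightarrow> (nat \<Rightarrow> 'a) \<Rightarrow> nat \<Rightarrow> 'a" where
  "prepend a e i = (if i < length a then a ! i else e (i - length a))"

lemma prepend_snoc: "prepend as (case_nat a e) = prepend (as @ [a]) e"
proof
  fix i
  show "prepend as (case_nat a e) i = prepend (as @ [a]) e i"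
  proof (cases "i - length as")
    case 0
    then show ?thesis by (auto simp: prepend_def nth_append less_Suc_eq)
  next
    case (Suc j)
    then have "i = length as + Suc j" by linarith
    then show ?thesis by (simp add: prepend_def)
  qed
qed

lemma sat_Exi_pow: "sat M e ((Exi ^^ n) p) \<longleftrightarrow> (\<exists>a. length a = n \<and> sat M (prepend a e) p)"
proof (induction n arbitrary: e)
  case 0
  have "prepend [] e = e" by (rule ext) (simp add: prepend_def)
  then show ?case by simp
next
  case (Suc n)
  have "sat M e ((Exi ^^ Suc n) p) \<longleftrightarrow> (\<exists>a as. length as = n \<and> sat M (prepend (as @ [a]) e) p)"
    by (simp add: Suc prepend_snoc)
  also have "\<dots> \<longleftrightarrow> (\<exists>a. length a = Suc n \<and> sat M (prepend a e) p)"
    by (metis length_Suc_conv_rev)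
  finally show ?case .
qed


section \<open>Rank as existence of splitting trees\<close>

lemma Neg_neq: "Neg p \<noteq> p" "p \<noteq> Neg p"
proof -
  have "size (Neg p) \<noteq> size p" by (simp add: Neg_def)
  then show "Neg p \<noteq> p" "p \<noteq> Neg p" by metis+
qed

text \<open>
  Contradiction is syntactic. The pair \<open>Neg \<psi>\<close>, \<open>Neg (Neg \<psi>)\<close> cannot witness it, since the
  latter is not a formula of a \<open>\<psi>\<close>-type; hence the witness is an instance of \<open>\<psi>\<close> itself.
\<close>

lemma explicitly_contradictory_local:
  assumes "local_type \<psi> l \<Delta>\<^sub>0" "local_type \<psi> l \<Delta>\<^sub>1" "explicitly_contradictory \<Delta>\<^sub>0 \<Delta>\<^sub>1"
  obtains b where "length b = l"
    "(\<psi>, b) \<in> \<Delta>\<^sub>0 \<and> (Neg \<psi>, b) \<in> \<Delta>\<^sub>1 \<or> (Neg \<psi>, b) \<in> \<Delta>\<^sub>0 \<and> (\<psi>, b) \<in> \<Delta>\<^sub>1"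
proof -
  obtain p b where pb: "(p, b) \<in> \<Delta>\<^sub>0 \<and> (Neg p, b) \<in> \<Delta>\<^sub>1 \<or> (Neg p, b) \<in> \<Delta>\<^sub>0 \<and> (p, b) \<in> \<Delta>\<^sub>1"
    using assms(3) by (auto simp: explicitly_contradictory_def)
  then have "p = \<psi> \<or> p = Neg \<psi>" "Neg p = \<psi> \<or> Neg p = Neg \<psi>" "length b = l"
    using assms(1,2) by (auto simp: local_type_def)
  moreover have "Neg (Neg \<psi>) \<noteq> \<psi>"
  proof -
    have "size (Neg (Neg \<psi>)) \<noteq> size \<psi>" by (simp add: Neg_def)
    then show ?thesis by metis
  qed
  ultimately have "p = \<psi>" "length b = l" using Neg_neq by metis+
  with pb that show thesis by blast
qed

text \<open>
  A contradictory pair of \<open>\<psi>\<close>-types can be shrunk to a single instance of \<open>\<psi>\<close> and its negation,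
  which is a split; conversely, a split is such a pair, and passing to a finite part of a type
  only enlarges its solution set.
\<close>

lemma rank2_ge_iff_splits:
  "rank2_ge M m \<psi> l n \<Gamma> \<longleftrightarrow>
     (\<forall>\<Delta>\<subseteq>\<Gamma>. finite \<Delta> \<longrightarrow>
        splits (\<lambda>x b. holds M \<psi> (x @ b)) {b. length b = l} n {x. realizes M m x \<Delta>})"
proof (induction n arbitrary: \<Gamma>)
  case 0
  show ?case by (auto simp: consistent_type_def)
next
  case (Suc n)
  let ?sp = "splits (\<lambda>x b. holds M \<psi> (x @ b)) {b. length b = l}"
  let ?sol = "\<lambda>\<Delta>. {x. realizes M m x \<Delta>}"
  have sol_insert: "?sol (insert (\<psi>, b) \<Delta>) = {x \<in> ?sol \<Delta>. holds M \<psi> (x @ b)}"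
      "?sol (insert (Neg \<psi>, b) \<Delta>) = {x \<in> ?sol \<Delta>. \<not> holds M \<psi> (x @ b)}" for b \<Delta>
    by (auto simp: realizes_def holds_def)
  have anti: "?sol \<Delta> \<subseteq> ?sol \<Delta>'" if "\<Delta>' \<subseteq> \<Delta>" for \<Delta> \<Delta>'
    using that by (auto simp: realizes_def)
  have "(\<exists>\<Delta>\<^sub>0 \<Delta>\<^sub>1. local_type \<psi> l \<Delta>\<^sub>0 \<and> local_type \<psi> l \<Delta>\<^sub>1 \<and> explicitly_contradictory \<Delta>\<^sub>0 \<Delta>\<^sub>1 \<and>
          rank2_ge M m \<psi> l n (\<Delta> \<union> \<Delta>\<^sub>0) \<and> rank2_ge M m \<psi> l n (\<Delta> \<union> \<Delta>\<^sub>1))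
        \<longleftrightarrow> ?sp (Suc n) (?sol \<Delta>)" (is "?rank \<longleftrightarrow> _") if "finite \<Delta>" for \<Delta>
  proof
    assume ?rank
    then obtain \<Delta>\<^sub>0 \<Delta>\<^sub>1 where d: "local_type \<psi> l \<Delta>\<^sub>0" "local_type \<psi> l \<Delta>\<^sub>1"
        "explicitly_contradictory \<Delta>\<^sub>0 \<Delta>\<^sub>1"
        and r: "rank2_ge M m \<psi> l n (\<Delta> \<union> \<Delta>\<^sub>0)" "rank2_ge M m \<psi> l n (\<Delta> \<union> \<Delta>\<^sub>1)"
      by blast
    from d obtain b where b: "length b = l"
        "(\<psi>, b) \<in> \<Delta>\<^sub>0 \<and> (Neg \<psi>, b) \<in> \<Delta>\<^sub>1 \<or> (Neg \<psi>, b) \<in> \<Delta>\<^sub>0 \<and> (\<psi>, b) \<in> \<Delta>\<^sub>1"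
      by (rule explicitly_contradictory_local)
    have s: "?sp n (?sol (insert q \<Delta>))" if "q \<in> \<Delta>\<^sub>0 \<or> q \<in> \<Delta>\<^sub>1" for q
      using that r \<open>finite \<Delta>\<close> unfolding Suc.IH by (metis finite_insert insert_subset Un_iff Un_upper1)
    have "?sp n {x \<in> ?sol \<Delta>. holds M \<psi> (x @ b)}" "?sp n {x \<in> ?sol \<Delta>. \<not> holds M \<psi> (x @ b)}"
      using b(2) s unfolding sol_insert[symmetric] by blast+
    with b(1) show "?sp (Suc n) (?sol \<Delta>)" by auto
  next
    assume "?sp (Suc n) (?sol \<Delta>)"
    then obtain b where b: "length b = l"
        "?sp n (?sol (insert (\<psi>, b) \<Delta>))" "?sp n (?sol (insert (Neg \<psi>, b) \<Delta>))"
      by (auto simp: sol_insert)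
    have r: "rank2_ge M m \<psi> l n (\<Delta> \<union> {(q, b)})" if "?sp n (?sol (insert (q, b) \<Delta>))" for q
      unfolding Suc.IH
    proof (intro allI impI)
      fix E assume "E \<subseteq> \<Delta> \<union> {(q, b)}"
      then have "E \<subseteq> insert (q, b) \<Delta>" by auto
      then show "?sp n (?sol E)" by (rule splits_mono[OF that anti])
    qed
    show ?rank
      by (rule exI[of _ "{(\<psi>, b)}"], rule exI[of _ "{(Neg \<psi>, b)}"])
        (use b r in \<open>auto simp: local_type_def explicitly_contradictory_def\<close>)
  qed
  then show ?case by auto
qed

lemma rank2_ge_omega_iff_splits:
  "rank2_ge_omega M m \<psi> l (x_eq_x m) \<longleftrightarrow>
     (\<forall>n. splits (\<lambda>x b. holds M \<psi> (x @ b)) {b. length b = l} n {x. length x = m})"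
proof -
  have "{x. realizes M m x \<Delta>} = {x. length x = m}" if "\<Delta> \<subseteq> x_eq_x m" for \<Delta>
    using that by (auto simp: realizes_def x_eq_x_def holds_def)
  moreover have "finite (x_eq_x m)" by (simp add: x_eq_x_def)
  ultimately show ?thesis
    unfolding rank2_ge_omega_def rank2_ge_iff_splits by auto
qed


section \<open>Saturation\<close>

text \<open>
  Assignments spare the bookkeeping of parameter tuples: as each formula has finitely many free
  variables, it only uses an initial segment of the countable family of parameters \<open>e\<close>.
\<close>

lemma saturation_env:
  assumes sat: "aleph1_saturated L M" and wf: "\<And>n::nat. wf_fm L (p n)"
    and fin: "\<And>n. \<exists>a. length a = k \<and> (\<forall>i\<le>n. sat M (prepend a e) (p i))"
  obtains a where "length a = k" "\<And>i. sat M (prepend a e) (p i)"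
proof -
  have "\<exists>N. fv (p n) \<subseteq> {..<N}" for n
    using finite_fv finite_nat_iff_bounded by blast
  then obtain N where N: "\<And>n. fv (p n) \<subseteq> {..<N n}" by metis
  define b where "b n = map e [0..<N n]" for n
  define \<Gamma> where "\<Gamma> = range (\<lambda>n. (p n, b n))"
  have holds: "holds M (p n) (a @ b n) \<longleftrightarrow> sat M (prepend a e) (p n)" for a n
    unfolding holds_def
    by (rule sat_cong) (use N[of n] in \<open>auto simp: prepend_def nth_append b_def\<close>)
  have "\<Gamma> \<subseteq> pfm_over L k (range e)"
    using wf N by (fastforce simp: \<Gamma>_def pfm_over_def b_def)
  moreover have "consistent_type M k \<Gamma>"
    unfolding consistent_type_def
  proof (intro allI impI)
    fix \<Delta> assume "\<Delta> \<subseteq> \<Gamma>" "finite \<Delta>"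
    from \<open>finite \<Delta>\<close> \<open>\<Delta> \<subseteq> \<Gamma>\<close>[unfolded \<Gamma>_def]
    have "\<exists>I\<subseteq>UNIV. finite I \<and> \<Delta> = (\<lambda>n. (p n, b n)) ` I"
      by (rule finite_subset_image)
    then obtain I where I: "finite I" "\<Delta> = (\<lambda>n. (p n, b n)) ` I"
      by blast
    obtain n where "I \<subseteq> {..n}" using I(1) finite_nat_iff_bounded_le by blast
    moreover obtain a where "length a = k" "\<forall>i\<le>n. sat M (prepend a e) (p i)"
      using fin by blast
    ultimately have "realizes M k a \<Delta>"
      by (auto simp: realizes_def I(2) holds)
    then show "\<exists>a. realizes M k a \<Delta>" ..
  qed
  moreover have "countable (range e)"
    by simp
  ultimately have "\<exists>a. realizes M k a \<Gamma>"
    using sat[unfolded aleph1_saturated_def, rule_format, where A = "range e" and m = k and \<Gamma> = \<Gamma>]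
    by simp
  then obtain a where "realizes M k a \<Gamma>" ..
  then show thesis
    by (intro that[of a]) (auto simp: realizes_def \<Gamma>_def holds)
qed

text \<open>
  Adding an instance of \<open>\<phi>\<close> to a formula makes room for the \<open>k\<close> new parameters directly after
  \<open>x\<close>, where \<open>\<phi>\<close> expects them.
\<close>

definition insert_vars :: "nat \<Rightarrow> nat \<Rightarrow> ('f, 'r) fm \<Rightarrow> ('f, 'r) fm" where
  "insert_vars m k = subst_fm (\<lambda>i. if i < m then Var i else Var (i + k))"

lemma wf_insert_vars: "wf_fm L p \<Longrightarrow> wf_fm L (insert_vars m k p)"
  by (simp add: insert_vars_def wf_subst_fm)

lemma sat_insert_vars:
  assumes "length x = m" "length y = k"
  shows "sat M (prepend x (prepend y e)) (insert_vars m k p) \<longleftrightarrow> sat M (prepend x e) p"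
  unfolding insert_vars_def sat_subst
  by (rule sat_cong) (use assms in \<open>auto simp: prepend_def\<close>)

lemma sat_prepend_prepend:
  assumes "length x = m" "length y = k" "fv p \<subseteq> {..<m + k}"
  shows "sat M (prepend x (prepend y e)) p \<longleftrightarrow> holds M p (x @ y)"
  unfolding holds_def
  by (rule sat_cong) (use assms in \<open>auto simp: prepend_def nth_append\<close>)

text \<open>
  The first \<open>m\<close> variables of \<open>q\<close> range over the set to be split, the others are parameters, which
  become the variables of \<open>splits_fm m k \<phi> n q\<close>. That this property of the parameters is first
  order is what makes saturation applicable to it.
\<close>

primrec splits_fm ::
    "nat \<Rightarrow> nat \<Rightarrow> ('f, 'r) fm \<Rightarrow> nat \<Rightarrow> ('f, 'r) fm \<Rightarrow> ('f, 'r) fm" where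
  "splits_fm m k \<phi> 0 q = (Exi ^^ m) q"
| "splits_fm m k \<phi> (Suc n) q = (Exi ^^ k) (And
     (splits_fm m k \<phi> n (And (insert_vars m k q) \<phi>))
     (splits_fm m k \<phi> n (And (insert_vars m k q) (Neg \<phi>))))"

lemma wf_splits_fm: "wf_fm L \<phi> \<Longrightarrow> wf_fm L q \<Longrightarrow> wf_fm L (splits_fm m k \<phi> n q)"
  by (induction n arbitrary: q) (simp_all add: wf_insert_vars)

definition solutions :: "('f, 'r, 'a) struct \<Rightarrow> nat \<Rightarrow> (nat \<Rightarrow> 'a) \<Rightarrow> ('f, 'r) fm \<Rightarrow> 'a list set" where
  "solutions M m e q = {x. length x = m \<and> sat M (prepend x e) q}"

lemma solutions_split:
  assumes "fv \<phi> \<subseteq> {..<m + k}" "length c = k"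
  shows "solutions M m (prepend c e) (And (insert_vars m k q) \<phi>)
      = {x \<in> solutions M m e q. holds M \<phi> (x @ c)}"
    and "solutions M m (prepend c e) (And (insert_vars m k q) (Neg \<phi>))
      = {x \<in> solutions M m e q. \<not> holds M \<phi> (x @ c)}"
  using assms by (auto simp: solutions_def sat_insert_vars sat_prepend_prepend)

lemma sat_splits_fm:
  assumes "fv \<phi> \<subseteq> {..<m + k}"
  shows "sat M e (splits_fm m k \<phi> n q) \<longleftrightarrow>
    splits (\<lambda>x b. holds M \<phi> (x @ b)) {b. length b = k} n (solutions M m e q)"
proof (induction n arbitrary: e q)
  case 0
  show ?case by (auto simp: sat_Exi_pow solutions_def)
next
  case (Suc n)
  show ?case
    by (simp add: sat_Exi_pow Bex_def Suc solutions_split[OF assms] cong: conj_cong)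
qed

text \<open>
  For each \<open>n\<close> some instance of \<open>\<phi>\<close> splits \<open>X\<close> into two parts splittable to depth \<open>n\<close>, and one
  that works for \<open>n\<close> works below \<open>n\<close>; a parameter that works for all \<open>n\<close> realizes a finitely
  satisfiable type.
\<close>

lemma unbounded_split:
  assumes sat: "aleph1_saturated L M"
    and wf: "wf_fm L \<phi>" "wf_fm L q" and fv: "fv \<phi> \<subseteq> {..<m + k}"
    and X: "\<And>n. splits (\<lambda>x b. holds M \<phi> (x @ b)) {b. length b = k} n (solutions M m e q)"
  obtains c where "length c = k"
    "\<And>n. splits (\<lambda>x b. holds M \<phi> (x @ b)) {b. length b = k} n
       {x \<in> solutions M m e q. holds M \<phi> (x @ c)}"
    "\<And>n. splits (\<lambda>x b. holds M \<phi> (x @ b)) {b. length b = k} n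
       {x \<in> solutions M m e q. \<not> holds M \<phi> (x @ c)}"
proof -
  define p where "p n = And (splits_fm m k \<phi> n (And (insert_vars m k q) \<phi>))
     (splits_fm m k \<phi> n (And (insert_vars m k q) (Neg \<phi>)))" for n
  let ?sp = "splits (\<lambda>x b. holds M \<phi> (x @ b)) {b. length b = k}"
  have p: "sat M (prepend c e) (p n) \<longleftrightarrow>
      ?sp n {x \<in> solutions M m e q. holds M \<phi> (x @ c)} \<and>
      ?sp n {x \<in> solutions M m e q. \<not> holds M \<phi> (x @ c)}" if "length c = k" for c n
    using that by (simp add: p_def sat_splits_fm[OF fv] solutions_split[OF fv])
  have "\<exists>c. length c = k \<and> (\<forall>i\<le>n. sat M (prepend c e) (p i))" for n
  proof -
    obtain c where "length c = k" "?sp n {x \<in> solutions M m e q. holds M \<phi> (x @ c)}"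
        "?sp n {x \<in> solutions M m e q. \<not> holds M \<phi> (x @ c)}"
      using X[of "Suc n"] by auto
    then show ?thesis using p splits_le by blast
  qed
  moreover have "wf_fm L (p n)" for n
    using wf by (simp add: p_def wf_splits_fm wf_insert_vars)
  ultimately obtain c where "length c = k" "\<And>n. sat M (prepend c e) (p n)"
    using saturation_env[OF sat] by metis
  with p that show thesis by blast
qed


section \<open>The characteristic sequence\<close>

lemma nth_concat_equal_lengths:
  assumes "\<forall>w\<in>set ws. length w = l" "i < length ws" "j < l"
  shows "concat ws ! (j + i * l) = ws ! i ! j"
  using assms
proof (induction ws arbitrary: i)
  case (Cons w ws)
  then show ?case by (cases i) (auto simp: nth_append)
qed simp

text \<open>
  The copies of \<open>\<theta>\<close> in \<open>P\<^sub>n\<close> are read off at offset \<open>i * l\<close> in the concatenated tuple, which is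
  correct as long as \<open>\<theta>\<close> looks at no variable beyond its \<open>m + l\<close> own ones. This locality is stated
  semantically because \<open>\<theta>\<close> will itself arise by substitution.
\<close>

lemma char_seq_iff:
  assumes local: "\<forall>e e'. (\<forall>i<m + l. e i = e' i) \<longrightarrow> sat M e \<theta> = sat M e' \<theta>"
  shows "char_seq M m l \<theta> n ws \<longleftrightarrow> length ws = n \<and> (\<forall>w\<in>set ws. length w = l) \<and>
    (\<exists>x. length x = m \<and> (\<forall>w\<in>set ws. holds M \<theta> (x @ w)))"
proof (cases "length ws = n \<and> (\<forall>w\<in>set ws. length w = l)")
  case True
  then have n: "length ws = n" and l: "\<forall>w\<in>set ws. length w = l" by auto
  have conjunct: "sat M (prepend x (\<lambda>i. concat ws ! i))
      (subst_fm (\<lambda>j. if j < m then Var j else Var (j + i * l)) \<theta>) \<longleftrightarrow> holds M \<theta> (x @ ws ! i)"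
    if "length x = m" "i < n" for x i
    unfolding sat_subst holds_def
  proof (rule local[rule_format])
    fix j assume "j < m + l"
    moreover have "concat ws ! (j + i * l - m) = ws ! i ! (j - m)" if "m \<le> j"
      using nth_concat_equal_lengths[OF l, of i "j - m"] that \<open>j < m + l\<close> \<open>i < n\<close> n by simp
    ultimately show "val M (prepend x (\<lambda>i. concat ws ! i)) (if j < m then Var j else Var (j + i * l))
        = (x @ ws ! i) ! j"
      using \<open>length x = m\<close> by (auto simp: prepend_def nth_append)
  qed
  have "(\<forall>p\<in>set (map (\<lambda>i. subst_fm (\<lambda>j. if j < m then Var j else Var (j + i * l)) \<theta>) [0..<n]).
        sat M (prepend x (\<lambda>i. concat ws ! i)) p) \<longleftrightarrow> (\<forall>i<n. holds M \<theta> (x @ ws ! i))"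
    if "length x = m" for x
    using conjunct[OF that] by auto
  then have "holds M (char_fm m l \<theta> n) (concat ws) \<longleftrightarrow>
      (\<exists>x. length x = m \<and> (\<forall>i<n. holds M \<theta> (x @ ws ! i)))"
    unfolding char_fm_def holds_def[of M "(Exi ^^ m) p" for p] sat_Exi_pow sat_Conj by blast
  with True show ?thesis
    by (auto simp: char_seq_def all_set_conv_all_nth)
qed (auto simp: char_seq_def)

lemma holds_theta:
  assumes "fv \<phi> \<subseteq> {..<m + k}" "length x = m" "length w = 2 * k"
  shows "holds M (theta m k \<phi>) (x @ w) \<longleftrightarrow>
    holds M \<phi> (x @ take k w) \<and> \<not> holds M \<phi> (x @ drop k w)"
proof -
  have "sat M (\<lambda>i. (x @ w) ! i) \<phi> = sat M (\<lambda>i. (x @ take k w) ! i) \<phi>"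
    by (rule sat_cong) (use assms in \<open>auto simp: nth_append\<close>)
  moreover have "sat M (\<lambda>i. val M (\<lambda>i. (x @ w) ! i) (if i < m then Var i else Var (i + k))) \<phi>
      = sat M (\<lambda>i. (x @ drop k w) ! i) \<phi>"
    by (rule sat_cong) (use assms in \<open>auto simp: nth_append add.commute\<close>)
  ultimately show ?thesis
    by (simp add: holds_def theta_def sat_subst)
qed

lemma sat_theta_cong:
  assumes "fv \<phi> \<subseteq> {..<m + k}"
  shows "\<forall>e e'. (\<forall>i<m + 2 * k. e i = e' i) \<longrightarrow>
    sat M e (theta m k \<phi>) = sat M e' (theta m k \<phi>)"
proof (intro allI impI)
  fix e e' :: "nat \<Rightarrow> 'c"
  assume eq: "\<forall>i<m + 2 * k. e i = e' i"
  have "sat M e \<phi> = sat M e' \<phi>"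
    by (rule sat_cong) (use assms eq in auto)
  moreover have "sat M (\<lambda>i. val M e (if i < m then Var i else Var (i + k))) \<phi>
      = sat M (\<lambda>i. val M e' (if i < m then Var i else Var (i + k))) \<phi>"
    by (rule sat_cong) (use assms eq in auto)
  ultimately show "sat M e (theta m k \<phi>) = sat M e' (theta m k \<phi>)"
    by (simp add: theta_def sat_subst)
qed

lemma sorted_wrt_prefix_last:
  "sorted_wrt prefix xs \<Longrightarrow> x \<in> set xs \<Longrightarrow> prefix x (last xs)"
  by (induction xs) auto

text \<open>
  The conditions \<open>P\<^sub>n\<close> on chains amount to joint satisfiability along each finite branch: a chain
  consists of initial segments of its last element, and all initial segments form a chain.
\<close>

lemma has_omega_2_diagram_iff:
  assumes local: "\<forall>e e'. (\<forall>i<m + l. e i = e' i) \<longrightarrow> sat M e \<theta> = sat M e' \<theta>"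
  shows "has_omega_2_diagram (char_seq M m l \<theta>) \<longleftrightarrow>
    (\<exists>a. (\<forall>\<eta>. length (a \<eta>) = l) \<and>
       (\<forall>\<eta> x. length x = m \<longrightarrow> holds M \<theta> (x @ a (\<eta> @ [False])) \<longrightarrow>
          \<not> holds M \<theta> (x @ a (\<eta> @ [True]))) \<and>
       (\<forall>\<eta>. \<exists>x. length x = m \<and> (\<forall>\<nu>. prefix \<nu> \<eta> \<longrightarrow> holds M \<theta> (x @ a \<nu>))))"
    (is "_ \<longleftrightarrow> (\<exists>a. ?len a \<and> ?siblings a \<and> ?branches a)")
proof -
  note iff = char_seq_iff[OF local]
  show ?thesis
    unfolding has_omega_2_diagram_def
  proof (intro iffI; elim exE conjE)
    fix a
    assume one: "\<forall>\<eta>. char_seq M m l \<theta> 1 [a \<eta>]"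
      and two: "\<forall>\<eta>. \<not> char_seq M m l \<theta> 2 [a (\<eta> @ [False]), a (\<eta> @ [True])]"
      and chains: "\<forall>n\<ge>1. \<forall>\<eta>s. length \<eta>s = n \<and> sorted_wrt prefix \<eta>s \<longrightarrow>
        char_seq M m l \<theta> n (map a \<eta>s)"
    have len: "?len a" using one by (simp add: iff)
    moreover have "?siblings a" using two len by (auto simp: iff)
    moreover have "?branches a"
    proof
      fix \<eta> :: "bool list"
      have "sorted_wrt prefix (prefixes \<eta>)"
        by (induction \<eta> rule: rev_induct) (auto simp: sorted_wrt_append)
      then have "char_seq M m l \<theta> (length (prefixes \<eta>)) (map a (prefixes \<eta>))"
        using chains[rule_format, of "length (prefixes \<eta>)" "prefixes \<eta>"] by simp
      then obtain x where "length x = m" "\<forall>w\<in>set (map a (prefixes \<eta>)). holds M \<theta> (x @ w)"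
        unfolding iff by blast
      then show "\<exists>x. length x = m \<and> (\<forall>\<nu>. prefix \<nu> \<eta> \<longrightarrow> holds M \<theta> (x @ a \<nu>))"
        by (intro exI[of _ x]) simp
    qed
    ultimately show "\<exists>a. ?len a \<and> ?siblings a \<and> ?branches a" by blast
  next
    fix a
    assume a: "?len a" "?siblings a" "?branches a"
    have "char_seq M m l \<theta> n (map a \<eta>s)" if "length \<eta>s = n" "sorted_wrt prefix \<eta>s" for n \<eta>s
    proof -
      obtain x where "length x = m" "\<forall>\<nu>. prefix \<nu> (last \<eta>s) \<longrightarrow> holds M \<theta> (x @ a \<nu>)"
        using a(3) by blast
      then show ?thesis
        using that a(1) sorted_wrt_prefix_last[OF that(2)] by (auto simp: iff)
    qed
    moreover from this[of "[\<eta>]" 1 for \<eta>] have "char_seq M m l \<theta> 1 [a \<eta>]" for \<eta>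
      by simp
    moreover have "\<not> char_seq M m l \<theta> 2 [a (\<eta> @ [False]), a (\<eta> @ [True])]" for \<eta>
      using a(2) by (auto simp: iff)
    ultimately show "\<exists>a. (\<forall>\<eta>. char_seq M m l \<theta> 1 [a \<eta>]) \<and>
        (\<forall>\<eta>. \<not> char_seq M m l \<theta> 2 [a (\<eta> @ [False]), a (\<eta> @ [True])]) \<and>
        (\<forall>n\<ge>1. \<forall>\<eta>s. length \<eta>s = n \<and> sorted_wrt prefix \<eta>s \<longrightarrow> char_seq M m l \<theta> n (map a \<eta>s))"
      by blast
  qed
qed


section \<open>The equivalence\<close>

theorem claim4p4:
  fixes L :: "('f, 'r) lang" and T :: "('f, 'r) fm set"
    and M :: "('f, 'r, 'a) struct"
    and \<phi> :: "('f, 'r) fm" and m k :: nat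
  assumes "complete_theory L T"
    and "models M T" and "aleph1_saturated L M"
    and "wf_fm L \<phi>" and "fv \<phi> \<subseteq> {..<m + k}"
  shows "(has_omega_2_diagram (char_seq M m (2 * k) (theta m k \<phi>))
            \<longleftrightarrow> rank2_ge_omega M m \<phi> k (x_eq_x m)) \<and>
         (rank2_ge_omega M m \<phi> k (x_eq_x m)
            \<longleftrightarrow> rank2_ge_omega M m (theta m k \<phi>) (2 * k) (x_eq_x m))"
proof -
  let ?\<theta> = "theta m k \<phi>"
  let ?U = "{x :: 'a list. length x = m}"
  let ?R = "\<lambda>x b. holds M \<phi> (x @ b)" and ?B = "{b :: 'a list. length b = k}"
  let ?S = "\<lambda>x w. holds M ?\<theta> (x @ w)" and ?C = "{w :: 'a list. length w = 2 * k}"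
  let ?diagram = "has_omega_2_diagram (char_seq M m (2 * k) ?\<theta>)"
  note fv = \<open>fv \<phi> \<subseteq> {..<m + k}\<close>
  note theta = holds_theta[OF fv, where M = M]
  note diagram_iff = has_omega_2_diagram_iff[of m "2 * k" M ?\<theta>, OF sat_theta_cong[OF fv]]
  have phi_to_diagram: ?diagram if unstable: "\<And>n. splits ?R ?B n ?U"
  proof -
    \<comment> \<open>Definability is part of the invariant, as saturation only speaks of definable sets.\<close>
    define good where "good X \<longleftrightarrow> (\<forall>n. splits ?R ?B n X) \<and>
      (\<exists>e q. wf_fm L q \<and> X = solutions M m e q)" for X
    have "?U = solutions M m e (Neg Bot)" for e
      by (simp add: solutions_def)
    then have root: "good ?U"
      unfolding good_def using unstable by (metis wf_Neg wf_fm.simps(1))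
    have step: "\<exists>c\<in>?B. good {x \<in> X. ?R x c} \<and> good {x \<in> X. \<not> ?R x c}" if X: "good X" for X
    proof -
      obtain e q where q: "wf_fm L q" "X = solutions M m e q"
        using X by (auto simp: good_def)
      then obtain c where c: "length c = k" "\<And>n. splits ?R ?B n {x \<in> X. ?R x c}"
          "\<And>n. splits ?R ?B n {x \<in> X. \<not> ?R x c}"
        using unbounded_split[OF assms(3,4) q(1) fv, of e] X by (auto simp: good_def)
      have "wf_fm L (And (insert_vars m k q) \<phi>)" "wf_fm L (And (insert_vars m k q) (Neg \<phi>))"
        using q(1) assms(4) by (simp_all add: wf_insert_vars)
      moreover note solutions_split[OF fv c(1), of M e q, folded q(2), symmetric]
      ultimately show ?thesis
        using c unfolding good_def by blast
    qed
    have nonempty: "X \<noteq> {}" if "good X" for X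
      using that unfolding good_def by (metis splits.simps(1))
    obtain y z :: "bool list \<Rightarrow> 'a list" where yz: "\<And>\<eta>. y \<eta> \<in> ?B" "\<And>\<eta>. z \<eta> \<in> ?B"
        "\<And>\<eta>. y (\<eta> @ [False]) = z (\<eta> @ [True])"
        "\<And>\<eta>. \<exists>x\<in>?U. \<forall>\<nu>. prefix \<nu> \<eta> \<longrightarrow> ?R x (y \<nu>) \<and> \<not> ?R x (z \<nu>)"
      by (rule bisection_tree[of good ?U ?B ?R, OF root step nonempty]) (assumption | rule that)+
    have S: "?S x (y \<eta> @ z \<eta>) \<longleftrightarrow> ?R x (y \<eta>) \<and> \<not> ?R x (z \<eta>)" if "length x = m" for x \<eta>
      using theta[OF that, of "y \<eta> @ z \<eta>"] yz(1,2)[of \<eta>] by simp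
    show ?thesis
      unfolding diagram_iff
    proof (intro exI[of _ "\<lambda>\<eta>. y \<eta> @ z \<eta>"] conjI allI impI)
      show "length (y \<eta> @ z \<eta>) = 2 * k" for \<eta>
        using yz(1,2)[of \<eta>] by simp
      show "\<not> ?S x (y (\<eta> @ [True]) @ z (\<eta> @ [True]))"
        if "length x = m" "?S x (y (\<eta> @ [False]) @ z (\<eta> @ [False]))" for \<eta> x
        using that(2) yz(3)[of \<eta>] unfolding S[OF that(1)] by simp
      show "\<exists>x. length x = m \<and> (\<forall>\<nu>. prefix \<nu> \<eta> \<longrightarrow> ?S x (y \<nu> @ z \<nu>))" for \<eta>
        using yz(4)[of \<eta>] S by auto
    qed
  qed
  have diagram_to_theta: "splits ?S ?C n ?U" if ?diagram for n
  proof -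
    from that obtain a where "\<forall>\<eta>. length (a \<eta>) = 2 * k"
        "\<forall>\<eta> x. length x = m \<longrightarrow> ?S x (a (\<eta> @ [False])) \<longrightarrow> \<not> ?S x (a (\<eta> @ [True]))"
        "\<forall>\<eta>. \<exists>x. length x = m \<and> (\<forall>\<nu>. prefix \<nu> \<eta> \<longrightarrow> ?S x (a \<nu>))"
      unfolding diagram_iff by blast
    then show ?thesis
      by (intro splits_of_diagram[where a = a]) auto
  qed
  have theta_to_phi: "splits ?R ?B n ?U" if "\<And>n. splits ?S ?C n ?U" for n
    by (rule splits_of_splits_diff[where S = ?S and C = ?C and U = ?U and f = "take k" and g = "drop k"])
      (use theta that in auto)
  show ?thesis
    unfolding rank2_ge_omega_iff_splits
    using phi_to_diagram diagram_to_theta theta_to_phi by blast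
qed

end
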